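(* Let $\mathcal U$ be an upper cluster algebra over a field $k$ of positive characteristic $p$. For any cluster $\mathbf x=\{x_1,\dots,x_n\}$, the standard splitting of the Laurent ring $k[x_1^{\pm1},\dots,x_n^{\pm1}]$ restricts to a Frobenius splitting $\mathcal U^{1/p}\to\mathcal U$ of $\mathcal U$. This splitting of $\mathcal U$ does not depend on the choice of cluster.
   Context: Cluster algebras. Let $k$ be a field and $\mathcal F$ a purely transcendental extension of $k$ of finite transcendence degree $n$. A seed $(Q,\mathbf x)$ for $\mathcal F$ over $k$ consists of: a finite quiver $Q$ with vertices $1,\dots,n$, without loops or directed 2-cycles (multiple arrows allowed); a cluster $\mathbf x=\{x_1,\dots,x_n\}$ of algebraically independent elements with $\mathcal F=k(x_1,\dots,x_n)$, where $x_i$ is the cluster variable at vertex $i$; and a subset of vertices designated frozen, the other vertices being mutable, with the convention that every vertex touching no arrow is frozen. Mutation of the seed at a mutable vertex $\ell$ gives a new seed: the quiver is changed by (1) adding an arrow $i\to j$ for each pair of arrows $i\to \ell\to j$, (2) reversing all arrows incident to $\ell$, (3) cancelling directed 2-cycles in pairs; all cluster variables stay the same except $x_\ell$, which is replaced by $x_\ell'=\big(\prod_{i\to \ell}x_i+\prod_{\ell\to i}x_i\big)x_\ell^{-1}$ (products over all arrows into, resp. out of, $\ell$); frozen vertices stay frozen. Seeds are mutation-equivalent if related by a sequence of mutations. The upper cluster algebra $\mathcal U$ of $(Q,\mathbf x)$ is the intersection in $\mathcal F$ of the Laurent rings $k[y_1^{\pm1},\dots,y_n^{\pm1}]$ over all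 clusters $\mathbf y=\{y_1,\dots,y_n\}$ of seeds mutation-equivalent to $(Q,\mathbf x)$. Frobenius notions. For a domain $R$ of characteristic $p>0$, $R^{1/p}\supseteq R$ is the ring of $p$-th roots of elements of $R$ in an algebraic closure of its fraction field. A Frobenius splitting of $R$ is an $R$-linear map $\phi:R^{1/p}\to R$ with $\phi|_R=\mathrm{id}_R$ (i.e. $\phi(1)=1$). The ground field $k$ comes with a fixed Frobenius splitting $\phi:k^{1/p}\to k$ (unique if $k$ is perfect). The standard splitting of the Laurent ring $L=k[x_1^{\pm1},\dots,x_n^{\pm1}]$ is the additive map $\phi:L^{1/p}\to L$ with $\phi\big((\lambda x_1^{a_1}\cdots x_n^{a_n})^{1/p}\big)=\phi(\lambda^{1/p})x_1^{a_1/p}\cdots x_n^{a_n/p}$ if all $a_i\in p\mathbb Z$, and $0$ otherwise, for $\lambda\in k$. *)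

theory Defs
  imports
    "HOL-Algebra.Algebraic_Closure_Type"
    "HOL-Algebra.Generated_Fields"
    "HOL-Algebra.Generated_Rings"
    "HOL-Library.Poly_Mapping"
    "HOL-Library.FuncSet"
begin

(* The field F is the type 'f, and the ground field k is a subfield K of it.  Families indexed
   by 1, ..., n are functions on nat of which only the values on {1..n} matter. *)

definition algebraically_independent :: "'f::field set \<Rightarrow> nat \<Rightarrow> (nat \<Rightarrow> 'f) \<Rightarrow> bool" where
  "algebraically_independent K n x \<longleftrightarrow>
     (\<forall>P :: (nat \<Rightarrow>\<^sub>0 nat) \<Rightarrow>\<^sub>0 'f.
        (\<forall>m \<in> Poly_Mapping.keys P. Poly_Mapping.keys m \<subseteq> {1..n} \<and> Poly_Mapping.lookup P m \<in> K) \<and>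
        (\<Sum>m \<in> Poly_Mapping.keys P.
            Poly_Mapping.lookup P m * (\<Prod>i=1..n. x i ^ Poly_Mapping.lookup m i)) = 0
        \<longrightarrow> P = 0)"

(* arrows S i j is the number of arrows from i to j; the vertices are 1, ..., n. *)
record 'f seed =
  arrows :: "nat \<Rightarrow> nat \<Rightarrow> nat"
  cluster :: "nat \<Rightarrow> 'f"
  frozen :: "nat set"

definition is_seed :: "'f::field set \<Rightarrow> nat \<Rightarrow> 'f seed \<Rightarrow> bool" where
  "is_seed K n S \<longleftrightarrow>
     (\<forall>i j. arrows S i j \<noteq> 0 \<longrightarrow> i \<in> {1..n} \<and> j \<in> {1..n}) \<and>
     (\<forall>i. arrows S i i = 0) \<and>
     (\<forall>i j. arrows S i j = 0 \<or> arrows S j i = 0) \<and>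
     algebraically_independent K n (cluster S) \<and>
     generate_field ring_of_type_algebra (K \<union> cluster S ` {1..n}) = UNIV \<and>
     frozen S \<subseteq> {1..n} \<and>
     (\<forall>i \<in> {1..n}. (\<forall>j. arrows S i j = 0 \<and> arrows S j i = 0) \<longrightarrow> i \<in> frozen S)"

definition add_composites :: "nat \<Rightarrow> (nat \<Rightarrow> nat \<Rightarrow> nat) \<Rightarrow> nat \<Rightarrow> nat \<Rightarrow> nat" where
  "add_composites l q i j = q i j + q i l * q l j"

definition reverse_at :: "nat \<Rightarrow> (nat \<Rightarrow> nat \<Rightarrow> nat) \<Rightarrow> nat \<Rightarrow> nat \<Rightarrow> nat" where
  "reverse_at l q i j = (if i = l \<or> j = l then q j i else q i j)"

definition cancel_2_cycles :: "(nat \<Rightarrow> nat \<Rightarrow> nat) \<Rightarrow> nat \<Rightarrow> nat \<Rightarrow> nat" where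
  "cancel_2_cycles q i j = q i j - min (q i j) (q j i)"

definition mutate :: "nat \<Rightarrow> nat \<Rightarrow> 'f::field seed \<Rightarrow> 'f seed" where
  "mutate n l S =
     \<lparr> arrows = cancel_2_cycles (reverse_at l (add_composites l (arrows S))),
       cluster = (cluster S)(l :=
         ((\<Prod>i=1..n. cluster S i ^ arrows S i l) + (\<Prod>i=1..n. cluster S i ^ arrows S l i))
           * inverse (cluster S l)),
       frozen = frozen S \<rparr>"

(* Mutation at a fixed vertex is an involution on seeds, so the reflexive-transitive
   closure is already symmetric on seeds. *)
definition mutation_equivalent :: "nat \<Rightarrow> 'f::field seed \<Rightarrow> 'f seed \<Rightarrow> bool" where
  "mutation_equivalent n = (\<lambda>S T. \<exists>l \<in> {1..n} - frozen S. T = mutate n l S)\<^sup>*\<^sup>*"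

definition laurent_ring :: "'f::field set \<Rightarrow> nat \<Rightarrow> (nat \<Rightarrow> 'f) \<Rightarrow> 'f set" where
  "laurent_ring K n x =
     generate_ring ring_of_type_algebra (K \<union> x ` {1..n} \<union> (\<lambda>i. inverse (x i)) ` {1..n})"

definition upper_cluster_algebra :: "'f::field set \<Rightarrow> nat \<Rightarrow> 'f seed \<Rightarrow> 'f set" where
  "upper_cluster_algebra K n S = (\<Inter>T \<in> {T. mutation_equivalent n S T}. laurent_ring K n (cluster T))"

(* R^(1/p), for a subring R of F.  The roots are taken in the algebraic closure of F, which
   contains an algebraic closure of Frac R; as p-th roots are unique in characteristic p,
   nothing depends on this choice. *)
definition pth_roots :: "nat \<Rightarrow> 'f::field set \<Rightarrow> 'f alg_closure set" where
  "pth_roots p R = {y. y ^ p \<in> to_ac ` R}"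

definition pth_root :: "nat \<Rightarrow> 'f::field \<Rightarrow> 'f alg_closure" where
  "pth_root p r = (THE y. y ^ p = to_ac r)"

(* R is meant to be a subring of F; only the values of \<phi> on R^(1/p) matter. *)
definition frobenius_splitting :: "nat \<Rightarrow> 'f::field set \<Rightarrow> ('f alg_closure \<Rightarrow> 'f) \<Rightarrow> bool" where
  "frobenius_splitting p R \<phi> \<longleftrightarrow>
     \<phi> \<in> pth_roots p R \<rightarrow> R \<and>
     (\<forall>y \<in> pth_roots p R. \<forall>z \<in> pth_roots p R. \<phi> (y + z) = \<phi> y + \<phi> z) \<and>
     (\<forall>r \<in> R. \<forall>y \<in> pth_roots p R. \<phi> (to_ac r * y) = r * \<phi> y) \<and>
     \<phi> 1 = 1"

definition laurent_monomial :: "nat \<Rightarrow> (nat \<Rightarrow> 'f::field) \<Rightarrow> (nat \<Rightarrow> int) \<Rightarrow> 'f" where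
  "laurent_monomial n x a = (\<Prod>i=1..n. x i powi a i)"

(* \<phi>\<^sub>0 is the splitting of the ground field.  The extensional function space fixes \<phi> to be
   undefined outside L^(1/p), which makes it unique; see standard_splitting_ex1 below. *)
definition is_standard_splitting ::
    "'f::field set \<Rightarrow> nat \<Rightarrow> nat \<Rightarrow> ('f alg_closure \<Rightarrow> 'f) \<Rightarrow> (nat \<Rightarrow> 'f) \<Rightarrow> ('f alg_closure \<Rightarrow> 'f) \<Rightarrow> bool" where
  "is_standard_splitting K n p \<phi>\<^sub>0 x \<phi> \<longleftrightarrow>
     (let L = laurent_ring K n x in
      \<phi> \<in> pth_roots p L \<rightarrow>\<^sub>E L \<and>
      (\<forall>y \<in> pth_roots p L. \<forall>z \<in> pth_roots p L. \<phi> (y + z) = \<phi> y + \<phi> z) \<and>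
      (\<forall>c \<in> K. \<forall>a.
         \<phi> (pth_root p (c * laurent_monomial n x a)) =
           (if \<forall>i \<in> {1..n}. int p dvd a i
            then \<phi>\<^sub>0 (pth_root p c) * laurent_monomial n x (\<lambda>i. a i div int p)
            else 0)))"

definition standard_splitting ::
    "'f::field set \<Rightarrow> nat \<Rightarrow> nat \<Rightarrow> ('f alg_closure \<Rightarrow> 'f) \<Rightarrow> (nat \<Rightarrow> 'f) \<Rightarrow> 'f alg_closure \<Rightarrow> 'f" where
  "standard_splitting K n p \<phi>\<^sub>0 x = (THE \<phi>. is_standard_splitting K n p \<phi>\<^sub>0 x \<phi>)"

(* The rest shows that standard_splitting is well defined.  lspan is the set of Laurent
   polynomials in x, written out as finite K-linear combinations of Laurent monomials. *)

lemma type_ring_simps [simp]: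
  "carrier (ring_of_type_algebra :: 'f::field ring) = UNIV"
  "\<zero>\<^bsub>ring_of_type_algebra\<^esub> = (0::'f)"
  "\<one>\<^bsub>ring_of_type_algebra\<^esub> = (1::'f)"
  "x \<oplus>\<^bsub>ring_of_type_algebra\<^esub> y = x + (y::'f)"
  "x \<otimes>\<^bsub>ring_of_type_algebra\<^esub> y = x * (y::'f)"
  by (simp_all add: ring_of_type_algebra_def)

lemma type_ring_uminus [simp]: "\<ominus>\<^bsub>ring_of_type_algebra\<^esub> x = - (x::'f::field)"
proof -
  interpret ring "ring_of_type_algebra :: 'f ring" by (rule ring_from_type_algebra)
  show ?thesis using minus_equality[of "-x" x] by simp
qed

definition fsupp :: "'f::field set \<Rightarrow> nat \<Rightarrow> ((nat \<Rightarrow> int) \<Rightarrow> 'f) \<Rightarrow> bool" where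
  "fsupp K n c \<longleftrightarrow> finite {a. c a \<noteq> 0} \<and> (\<forall>a. c a \<in> K) \<and> (\<forall>a i. c a \<noteq> 0 \<longrightarrow> i \<notin> {1..n} \<longrightarrow> a i = 0)"

definition lcomb :: "nat \<Rightarrow> (nat \<Rightarrow> 'f::field) \<Rightarrow> ((nat \<Rightarrow> int) \<Rightarrow> 'f) \<Rightarrow> 'f" where
  "lcomb n x c = (\<Sum>a | c a \<noteq> 0. c a * laurent_monomial n x a)"

definition lspan :: "'f::field set \<Rightarrow> nat \<Rightarrow> (nat \<Rightarrow> 'f) \<Rightarrow> 'f set" where
  "lspan K n x = {lcomb n x c | c. fsupp K n c}"

context
  fixes K :: "'f::field set" and n :: nat and x :: "nat \<Rightarrow> 'f"
  assumes K: "subfield K ring_of_type_algebra"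
begin

lemma K0: "0 \<in> K" and K1: "1 \<in> K" and Kadd: "a \<in> K \<Longrightarrow> b \<in> K \<Longrightarrow> a + b \<in> K"
  and Kmult: "a \<in> K \<Longrightarrow> b \<in> K \<Longrightarrow> a * b \<in> K" and Kminus: "a \<in> K \<Longrightarrow> - a \<in> K"
proof -
  interpret ring "ring_of_type_algebra :: 'f ring" by (rule ring_from_type_algebra)
  have *: "subring K ring_of_type_algebra"
    using K by (simp add: subfield_def subdomain_def subcring_def)
  note s = subringE[OF *]
  show "0 \<in> K" "1 \<in> K" "a \<in> K \<Longrightarrow> b \<in> K \<Longrightarrow> a + b \<in> K"
    "a \<in> K \<Longrightarrow> b \<in> K \<Longrightarrow> a * b \<in> K" "a \<in> K \<Longrightarrow> - a \<in> K"
    using s(2,3) s(5)[of a] s(6,7)[of a b] by simp_all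
qed

lemma lcomb_superset:
  assumes "finite A" "{a. c a \<noteq> 0} \<subseteq> A"
  shows "lcomb n x c = (\<Sum>a\<in>A. c a * laurent_monomial n x a)"
  unfolding lcomb_def using assms by (intro sum.mono_neutral_left) auto

lemma fsupp_add: "fsupp K n c \<Longrightarrow> fsupp K n d \<Longrightarrow> fsupp K n (\<lambda>a. c a + d a)"
  and lcomb_add: "fsupp K n c \<Longrightarrow> fsupp K n d \<Longrightarrow> lcomb n x (\<lambda>a. c a + d a) = lcomb n x c + lcomb n x d"
proof -
  assume c: "fsupp K n c" and d: "fsupp K n d"
  let ?A = "{a. c a \<noteq> 0} \<union> {a. d a \<noteq> 0}"
  have fA: "finite ?A" and sub: "{a. c a + d a \<noteq> 0} \<subseteq> ?A" using c d by (auto simp: fsupp_def)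
  have "a i = 0" if "c a + d a \<noteq> 0" "i \<notin> {1..n}" for a i
  proof -
    have "c a \<noteq> 0 \<or> d a \<noteq> 0" using that(1) by auto
    thus ?thesis using c d that(2) unfolding fsupp_def by blast
  qed
  thus "fsupp K n (\<lambda>a. c a + d a)"
    using c d finite_subset[OF sub fA] unfolding fsupp_def by (simp add: Kadd)
  show "lcomb n x (\<lambda>a. c a + d a) = lcomb n x c + lcomb n x d"
    using lcomb_superset[OF fA sub] lcomb_superset[OF fA, of c] lcomb_superset[OF fA, of d]
    by (simp add: sum.distrib distrib_right)
qed

lemma fsupp_uminus: "fsupp K n c \<Longrightarrow> fsupp K n (\<lambda>a. - c a)"
  by (auto simp: fsupp_def Kminus)

lemma lcomb_uminus: "lcomb n x (\<lambda>a. - c a) = - lcomb n x c"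
  by (simp add: lcomb_def sum_negf)

lemma monomial_restrict:
  "laurent_monomial n x (\<lambda>i. if i \<in> {1..n} then a i else 0) = laurent_monomial n x a"
  unfolding laurent_monomial_def by (intro prod.cong) auto

lemma single:
  fixes c :: 'f and a :: "nat \<Rightarrow> int"
  assumes "c \<in> K"
  defines "f \<equiv> (\<lambda>b. if b = (\<lambda>i. if i \<in> {1..n} then a i else 0) then c else 0)"
  shows "fsupp K n f" "lcomb n x f = c * laurent_monomial n x a"
proof -
  let ?a = "\<lambda>i. if i \<in> {1..n} then a i else 0"
  have sub: "{b. f b \<noteq> 0} \<subseteq> {?a}" by (auto simp: f_def)
  show "fsupp K n f" using finite_subset[OF sub] assms(1) by (auto simp: fsupp_def f_def K0)
  show "lcomb n x f = c * laurent_monomial n x a"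
    using lcomb_superset[OF _ sub] monomial_restrict[of a] by (simp add: f_def)
qed

lemma lspanI: "fsupp K n c \<Longrightarrow> lcomb n x c \<in> lspan K n x"
  by (auto simp: lspan_def)

lemma lspanE: "u \<in> lspan K n x \<Longrightarrow> \<exists>c. fsupp K n c \<and> u = lcomb n x c"
  by (auto simp: lspan_def)

lemma term_lspan: "c \<in> K \<Longrightarrow> c * laurent_monomial n x a \<in> lspan K n x"
  using lspanI[OF single(1)] single(2) by simp

lemma lspan_add: "u \<in> lspan K n x \<Longrightarrow> v \<in> lspan K n x \<Longrightarrow> u + v \<in> lspan K n x"
  using lspanI[OF fsupp_add] by (auto dest!: lspanE simp: lcomb_add)

lemma lspan_0: "0 \<in> lspan K n x"
  using term_lspan[OF K0] by simp

lemma lspan_sum: "(\<And>i. i \<in> A \<Longrightarrow> f i \<in> lspan K n x) \<Longrightarrow> sum f A \<in> lspan K n x"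
  by (induction A rule: infinite_finite_induct) (auto intro: lspan_add lspan_0)

lemma lspan_uminus: "u \<in> lspan K n x \<Longrightarrow> - u \<in> lspan K n x"
  using lspanI[OF fsupp_uminus] by (auto dest!: lspanE simp: lcomb_uminus)

context
  assumes x: "\<And>i. i \<in> {1..n} \<Longrightarrow> x i \<noteq> 0"
begin

lemma monomial_add:
  "laurent_monomial n x (\<lambda>i. a i + b i) = laurent_monomial n x a * laurent_monomial n x b"
  unfolding laurent_monomial_def prod.distrib[symmetric]
  by (intro prod.cong refl power_int_add) (use x in auto)

lemma lspan_mult: assumes "u \<in> lspan K n x" "v \<in> lspan K n x" shows "u * v \<in> lspan K n x"
proof -
  from assms obtain c d where c: "fsupp K n c" "u = lcomb n x c" and d: "fsupp K n d" "v = lcomb n x d"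
    by (auto simp: lspan_def)
  have "u * v = (\<Sum>a | c a \<noteq> 0. \<Sum>b | d b \<noteq> 0. (c a * d b) * laurent_monomial n x (\<lambda>i. a i + b i))"
    unfolding c(2) d(2) lcomb_def sum_product monomial_add by (simp add: algebra_simps)
  also have "\<dots> \<in> lspan K n x"
    using c(1) d(1) by (intro lspan_sum term_lspan Kmult) (auto simp: fsupp_def)
  finally show ?thesis .
qed

lemma monomial_unit:
  assumes "j \<in> {1..n}"
  shows "laurent_monomial n x (\<lambda>i. if i = j then e else 0) = x j powi e"
proof -
  have "laurent_monomial n x (\<lambda>i. if i = j then e else 0) = (\<Prod>i\<in>{1..n}. if i = j then x j powi e else 1)"
    unfolding laurent_monomial_def by (intro prod.cong) auto
  thus ?thesis using assms by simp
qed

lemma laurent_ring_subset: "laurent_ring K n x \<subseteq> lspan K n x"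
proof
  fix z assume "z \<in> laurent_ring K n x"
  thus "z \<in> lspan K n x" unfolding laurent_ring_def
  proof (induction rule: generate_ring.induct)
    case one
    show ?case using term_lspan[OF K1, of "\<lambda>_. 0"] by (simp add: laurent_monomial_def)
  next
    case (incl h)
    then consider "h \<in> K" | j where "j \<in> {1..n}" "h = x j" | j where "j \<in> {1..n}" "h = inverse (x j)"
      by auto
    thus ?case
    proof cases
      case 1
      thus ?thesis using term_lspan[of h "\<lambda>_. 0"] by (simp add: laurent_monomial_def)
    next
      case 2
      thus ?thesis using term_lspan[OF K1, of "\<lambda>i. if i = j then 1 else 0"] monomial_unit[of j 1] by simp
    next
      case 3
      thus ?thesis using term_lspan[OF K1, of "\<lambda>i. if i = j then -1 else 0"] monomial_unit[of j "-1"]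
        by (simp add: power_int_minus)
    qed
  qed (auto intro: lspan_add lspan_mult lspan_uminus)
qed

lemma L_add: "u \<in> laurent_ring K n x \<Longrightarrow> v \<in> laurent_ring K n x \<Longrightarrow> u + v \<in> laurent_ring K n x"
  and L_mult: "u \<in> laurent_ring K n x \<Longrightarrow> v \<in> laurent_ring K n x \<Longrightarrow> u * v \<in> laurent_ring K n x"
  and L_1: "1 \<in> laurent_ring K n x"
  and L_0: "0 \<in> laurent_ring K n x"
  unfolding laurent_ring_def
  using generate_ring.eng_add[of u ring_of_type_algebra _ v] generate_ring.eng_mult[of u ring_of_type_algebra _ v]
    generate_ring.one[of "ring_of_type_algebra :: 'f ring"] generate_ring.incl[of 0 _ "ring_of_type_algebra :: 'f ring"] K0
  by (auto simp del: One_nat_def)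

lemma L_pow: "u \<in> laurent_ring K n x \<Longrightarrow> u ^ k \<in> laurent_ring K n x"
  by (induction k) (auto intro: L_mult L_1)

lemma L_sum: "(\<And>i. i \<in> A \<Longrightarrow> f i \<in> laurent_ring K n x) \<Longrightarrow> sum f A \<in> laurent_ring K n x"
  by (induction A rule: infinite_finite_induct) (auto intro: L_add L_0)

lemma L_prod: "(\<And>i. i \<in> A \<Longrightarrow> f i \<in> laurent_ring K n x) \<Longrightarrow> prod f A \<in> laurent_ring K n x"
  by (induction A rule: infinite_finite_induct) (auto intro: L_mult L_1)

lemma L_term: assumes "c \<in> K" shows "c * laurent_monomial n x a \<in> laurent_ring K n x"
proof (rule L_mult)
  show "c \<in> laurent_ring K n x" using assms unfolding laurent_ring_def by (auto intro: generate_ring.incl)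
  show "laurent_monomial n x a \<in> laurent_ring K n x" unfolding laurent_monomial_def
  proof (rule L_prod)
    fix i assume "i \<in> {1..n}"
    hence "x i \<in> laurent_ring K n x" "inverse (x i) \<in> laurent_ring K n x"
      unfolding laurent_ring_def by (auto intro: generate_ring.incl)
    thus "x i powi a i \<in> laurent_ring K n x" by (auto simp: power_int_def intro!: L_pow)
  qed
qed

end

lemma alg_indep_finite:
  assumes ind: "algebraically_independent K n x"
    and B: "finite B" "\<And>m. m \<in> B \<Longrightarrow> Poly_Mapping.keys m \<subseteq> {1..n}" "\<And>m. m \<in> B \<Longrightarrow> d m \<in> K"
    and eq: "(\<Sum>m \<in> B. d m * (\<Prod>i=1..n. x i ^ Poly_Mapping.lookup m i)) = 0"
    and m: "m \<in> B"
  shows "d m = 0"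
proof -
  define P where "P = Abs_poly_mapping (\<lambda>m. if m \<in> B then d m else 0)"
  have "finite {m. (if m \<in> B then d m else 0) \<noteq> 0}"
    by (rule finite_subset[OF _ B(1)]) auto
  hence l: "Poly_Mapping.lookup P = (\<lambda>m. if m \<in> B then d m else 0)"
    unfolding P_def by (simp add: Abs_poly_mapping_inverse)
  have k: "Poly_Mapping.keys P \<subseteq> B" by (auto simp: in_keys_iff l split: if_splits)
  have "(\<Sum>m \<in> Poly_Mapping.keys P. Poly_Mapping.lookup P m * (\<Prod>i=1..n. x i ^ Poly_Mapping.lookup m i))
      = (\<Sum>m \<in> B. Poly_Mapping.lookup P m * (\<Prod>i=1..n. x i ^ Poly_Mapping.lookup m i))"
    using B(1) k by (intro sum.mono_neutral_left) (auto simp: in_keys_iff)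
  also have "\<dots> = 0" using eq by (simp add: l)
  finally have "P = 0"
    using ind B k l unfolding algebraically_independent_def by (metis (lifting) subsetD)
  thus ?thesis using l m by (metis lookup_zero)
qed

lemma alg_indep_nz:
  assumes ind: "algebraically_independent K n x" and j: "j \<in> {1..n}"
  shows "x j \<noteq> 0"
proof
  assume x0: "x j = 0"
  let ?m = "Poly_Mapping.single j (1::nat)"
  have "(\<Prod>i=1..n. x i ^ Poly_Mapping.lookup ?m i) = 0"
    using j x0 by (intro prod_zero) (auto simp: lookup_single intro!: bexI[of _ j])
  thus False using alg_indep_finite[OF ind, of "{?m}" "\<lambda>_. 1" ?m] j K1 by simp
qed

lemma lcomb_0:
  assumes ind: "algebraically_independent K n x" and c: "fsupp K n c" and eq: "lcomb n x c = 0"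
  shows "c a = 0"
proof (rule ccontr)
  assume ca: "c a \<noteq> 0"
  let ?A = "{a. c a \<noteq> 0}"
  have fA: "finite ?A" using c by (simp add: fsupp_def)
  define T where "T = insert 0 ((\<lambda>(a,i). - a i) ` (?A \<times> {1..n}))"
  define N where "N = Max T"
  have fT: "finite T" using fA by (simp add: T_def)
  have N: "a i + N \<ge> 0" if "c a \<noteq> 0" "i \<in> {1..n}" for a i
  proof -
    have "- a i \<in> T" using that unfolding T_def by force
    thus ?thesis using Max_ge[OF fT] unfolding N_def by fastforce
  qed
  define h where "h = (\<lambda>a. Abs_poly_mapping (\<lambda>i. if i \<in> {1..n} then nat (a i + N) else 0))"
  have h: "Poly_Mapping.lookup (h a) = (\<lambda>i. if i \<in> {1..n} then nat (a i + N) else 0)" for a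
  proof -
    have "finite {i. (if i \<in> {1..n} then nat (a i + N) else 0) \<noteq> 0}"
      by (rule finite_subset[of _ "{1..n}"]) auto
    thus ?thesis unfolding h_def by (simp add: Abs_poly_mapping_inverse)
  qed
  have inj: "inj_on h ?A"
  proof (rule inj_onI)
    fix a b assume a: "a \<in> ?A" and b: "b \<in> ?A" and "h a = h b"
    hence e: "(if i \<in> {1..n} then nat (a i + N) else 0) = (if i \<in> {1..n} then nat (b i + N) else 0)" for i
      by (metis h)
    show "a = b"
    proof
      fix i show "a i = b i"
      proof (cases "i \<in> {1..n}")
        case True
        thus ?thesis using e[of i] N[of a i] N[of b i] a b by auto
      next
        case False
        hence "a i = 0" "b i = 0" using a b c unfolding fsupp_def by blast+
        thus ?thesis by simp
      qed
    qed
  qed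
  have mono: "(\<Prod>i=1..n. x i ^ Poly_Mapping.lookup (h a) i)
      = laurent_monomial n x a * laurent_monomial n x (\<lambda>_. N)" if "c a \<noteq> 0" for a
  proof -
    have "(\<Prod>i=1..n. x i ^ Poly_Mapping.lookup (h a) i) = laurent_monomial n x (\<lambda>i. a i + N)"
      unfolding laurent_monomial_def using N[OF that]
      by (intro prod.cong refl) (simp add: h power_int_def)
    thus ?thesis using monomial_add[OF alg_indep_nz[OF ind], where a = a and b = "\<lambda>_. N"] by simp
  qed
  have "(\<Sum>m\<in>h ` ?A. c (inv_into ?A h m) * (\<Prod>i=1..n. x i ^ Poly_Mapping.lookup m i))
      = (\<Sum>a\<in>?A. c a * (laurent_monomial n x a * laurent_monomial n x (\<lambda>_. N)))"
    unfolding sum.reindex[OF inj] using inj mono by (intro sum.cong) auto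
  also have "\<dots> = lcomb n x c * laurent_monomial n x (\<lambda>_. N)"
    unfolding lcomb_def sum_distrib_right by (simp add: mult.assoc)
  finally have z: "(\<Sum>m\<in>h ` ?A. c (inv_into ?A h m) * (\<Prod>i=1..n. x i ^ Poly_Mapping.lookup m i)) = 0"
    using eq by simp
  have "c (inv_into ?A h (h a)) = 0"
  proof (rule alg_indep_finite[OF ind _ _ _ z])
    show "finite (h ` ?A)" using fA by simp
    show "h a \<in> h ` ?A" using ca by simp
    show "c (inv_into ?A h m) \<in> K" for m using c by (simp add: fsupp_def)
    show "Poly_Mapping.keys m \<subseteq> {1..n}" if "m \<in> h ` ?A" for m
      using that by (auto simp: in_keys_iff h split: if_splits)
  qed
  thus False using ca inj by simp
qed

lemma lcomb_inj:
  assumes ind: "algebraically_independent K n x" and c: "fsupp K n c" and d: "fsupp K n d"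
    and eq: "lcomb n x c = lcomb n x d"
  shows "c = d"
proof
  fix a
  have "c a + - d a = 0"
    using lcomb_0[OF ind fsupp_add[OF c fsupp_uminus[OF d]], of a] lcomb_add[OF c fsupp_uminus[OF d]] eq
    by (simp add: lcomb_uminus)
  thus "c a = d a" by simp
qed

lemma standard_splitting_ex1:
  assumes p: "CHAR('f) = p" "p > 0" and phi: "frobenius_splitting p K \<phi>\<^sub>0"
    and ind: "algebraically_independent K n x"
  shows "\<exists>!\<phi>. is_standard_splitting K n p \<phi>\<^sub>0 x \<phi>"
proof -
  let ?L = "laurent_ring K n x" and ?M = "laurent_monomial n x"
  have pr: "prime p" using p prime_CHAR_semidom[where 'a = 'f] by auto
  have CH: "CHAR('f alg_closure) = p" using p by simp
  have prA: "prime CHAR('f alg_closure)" using CH pr by simp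
  have fd: "(u + v) ^ p = u ^ p + v ^ p" for u v :: "'f alg_closure"
    using freshmans_dream[OF prA, of p u v] CH by simp
  note nz = alg_indep_nz[OF ind]
  have roots_inj: "u = v" if "u ^ p = v ^ p" for u v :: "'f alg_closure"
  proof -
    have "(u - v) ^ p + v ^ p = u ^ p" using fd[of "u - v" v] by simp
    hence "(u - v) ^ p = 0" using that by simp
    thus ?thesis using p by simp
  qed
  have root: "pth_root p r ^ p = to_ac r" for r :: 'f
  proof -
    obtain y where "y ^ p = to_ac r" using nth_root_exists[OF p(2)] by blast
    thus ?thesis unfolding pth_root_def by (rule theI) (use \<open>y ^ p = to_ac r\<close> roots_inj in auto)
  qed
  have rootI: "y = pth_root p r" if "y ^ p = to_ac r" for y and r :: 'f
    using roots_inj[of y "pth_root p r"] root that by simp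
  have root_add: "pth_root p (r + s) = pth_root p r + pth_root p s" for r s :: 'f
    by (rule rootI[symmetric]) (simp add: fd root)
  have root_in: "pth_root p r \<in> pth_roots p R \<longleftrightarrow> r \<in> R" for r :: 'f and R
    by (auto simp: pth_roots_def root)
  have rootE: "\<exists>r\<in>R. y = pth_root p r" if "y \<in> pth_roots p R" for R :: "'f set" and y
    using that rootI by (auto simp: pth_roots_def)
  have root0: "pth_root p (0::'f) = 0" using rootI[of 0 0] p by simp
  define C where "C = (\<lambda>z. SOME c. fsupp K n c \<and> lcomb n x c = z)"
  have C: "fsupp K n (C z) \<and> lcomb n x (C z) = z" if z: "z \<in> ?L" for z
  proof -
    have "z \<in> lspan K n x" using laurent_ring_subset[OF nz] z by blast
    hence "\<exists>c. fsupp K n c \<and> lcomb n x c = z" by (auto simp: lspan_def)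
    thus ?thesis unfolding C_def by (rule someI_ex)
  qed
  have C_eq: "C (lcomb n x c) = c" if "fsupp K n c" "lcomb n x c \<in> ?L" for c
    using C[OF that(2)] lcomb_inj[OF ind _ that(1)] by blast
  have C_add: "C (u + v) = (\<lambda>a. C u a + C v a)" if "u \<in> ?L" "v \<in> ?L" for u v
    using C_eq[OF fsupp_add, of "C u" "C v"] lcomb_add[of "C u" "C v"] C[OF that(1)] C[OF that(2)]
      L_add[OF nz that] by simp
  define G where "G = (\<lambda>c a. if \<forall>i\<in>{1..n}. int p dvd a i
      then \<phi>\<^sub>0 (pth_root p c) * ?M (\<lambda>i. a i div int p) else 0)"
  have phi_add: "\<phi>\<^sub>0 (pth_root p (u + v)) = \<phi>\<^sub>0 (pth_root p u) + \<phi>\<^sub>0 (pth_root p v)" if "u \<in> K" "v \<in> K" for u v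
    using phi that root_in[of u K] root_in[of v K] by (simp add: frobenius_splitting_def root_add)
  have phi_in: "\<phi>\<^sub>0 (pth_root p u) \<in> K" if "u \<in> K" for u
    using phi that root_in[of u K] by (auto simp: frobenius_splitting_def)
  have phi0: "\<phi>\<^sub>0 (pth_root p 0) = 0" using phi_add[OF K0 K0] by (metis add_0 add_cancel_right_right)
  have G0: "G 0 a = 0" for a using phi0 by (simp add: G_def)
  have G_add: "G (u + v) a = G u a + G v a" if "u \<in> K" "v \<in> K" for u v a
    using phi_add[OF that] by (simp add: G_def distrib_right)
  have G_in: "G u a \<in> ?L" if "u \<in> K" for u a
    using that L_term[OF nz phi_in] L_0[OF nz] by (simp add: G_def)
  have G_restr: "G c (\<lambda>i. if i \<in> {1..n} then a i else 0) = G c a" for c a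
  proof -
    have "?M (\<lambda>i. (if i \<in> {1..n} then a i else 0) div int p) = ?M (\<lambda>i. a i div int p)"
      unfolding laurent_monomial_def by (intro prod.cong) auto
    thus ?thesis by (auto simp: G_def)
  qed
  define H where "H = (\<lambda>c. \<Sum>a | c a \<noteq> 0. G (c a) a)"
  have H_sup: "H c = (\<Sum>a\<in>A. G (c a) a)" if "finite A" "{a. c a \<noteq> 0} \<subseteq> A" for c A
    unfolding H_def using that by (intro sum.mono_neutral_left) (auto simp: G0)
  have H_add: "H (\<lambda>a. c a + d a) = H c + H d" if "fsupp K n c" "fsupp K n d" for c d
  proof -
    let ?A = "{a. c a \<noteq> 0} \<union> {a. d a \<noteq> 0}"
    have fA: "finite ?A" and sub: "{a. c a + d a \<noteq> 0} \<subseteq> ?A" using that by (auto simp: fsupp_def)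
    show ?thesis
      using H_sup[OF fA sub] H_sup[OF fA, of c] H_sup[OF fA, of d] that
      by (simp add: sum.distrib[symmetric] fsupp_def G_add)
  qed
  define F where "F = (\<lambda>y. if y \<in> pth_roots p ?L then H (C (of_ac (y ^ p))) else undefined)"
  have F: "F (pth_root p z) = H (C z)" if "z \<in> ?L" for z
    using that by (simp add: F_def root_in root)
  have "is_standard_splitting K n p \<phi>\<^sub>0 x F"
    unfolding is_standard_splitting_def Let_def
  proof (intro conjI ballI allI)
    show "F \<in> pth_roots p ?L \<rightarrow>\<^sub>E ?L"
    proof (rule PiE_I)
      fix y assume "y \<in> pth_roots p ?L"
      then obtain z where z: "z \<in> ?L" "y = pth_root p z" using rootE by blast
      show "F y \<in> ?L" unfolding z(2) F[OF z(1)] H_def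
        using C[OF z(1)] by (intro L_sum nz G_in) (auto simp: fsupp_def)
    qed (simp add: F_def)
  next
    fix y w assume "y \<in> pth_roots p ?L" "w \<in> pth_roots p ?L"
    then obtain u v where u: "u \<in> ?L" "y = pth_root p u" and v: "v \<in> ?L" "w = pth_root p v"
      using rootE by meson
    show "F (y + w) = F y + F w"
      using F[OF L_add[OF nz u(1) v(1)]] F[OF u(1)] F[OF v(1)] C[OF u(1)] C[OF v(1)]
      by (simp add: u(2) v(2) root_add C_add u(1) v(1) H_add)
  next
    fix c and a :: "nat \<Rightarrow> int" assume c: "c \<in> K"
    let ?a = "\<lambda>i. if i \<in> {1..n} then a i else 0"
    let ?f = "\<lambda>b. if b = ?a then c else 0"
    have "C (c * ?M a) = ?f"
      using C_eq[OF single(1)[OF c, of a]] single(2)[OF c, of a] L_term[OF nz c, of a] by simp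
    moreover have "{b. ?f b \<noteq> 0} \<subseteq> {?a}" by auto
    hence "H ?f = G c a" using H_sup[of "{?a}" ?f] G_restr[of c a] by simp
    ultimately show "F (pth_root p (c * ?M a)) = (if \<forall>i \<in> {1..n}. int p dvd a i
            then \<phi>\<^sub>0 (pth_root p c) * ?M (\<lambda>i. a i div int p) else 0)"
      using F[OF L_term[OF nz c, of a]] by (simp add: G_def)
  qed
  moreover have "\<psi> = \<psi>'" if 1: "is_standard_splitting K n p \<phi>\<^sub>0 x \<psi>"
      and 2: "is_standard_splitting K n p \<phi>\<^sub>0 x \<psi>'" for \<psi> \<psi>'
  proof -
    have *: "\<psi> (pth_root p z) = H (C z)" if s: "is_standard_splitting K n p \<phi>\<^sub>0 x \<psi>" and z: "z \<in> ?L" for \<psi> z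
    proof -
      have add: "\<psi> (pth_root p (u + v)) = \<psi> (pth_root p u) + \<psi> (pth_root p v)"
        if "u \<in> ?L" "v \<in> ?L" for u v
        using s that unfolding is_standard_splitting_def Let_def by (simp add: root_in root_add)
      have "\<psi> (pth_root p 0) + 0 = \<psi> (pth_root p 0) + \<psi> (pth_root p 0)"
        using add[OF L_0[OF nz] L_0[OF nz]] by (simp del: add_left_cancel)
      hence "\<psi> (pth_root p 0) = 0" unfolding add_left_cancel by simp
      hence sum: "\<psi> (pth_root p (sum f A)) = (\<Sum>a\<in>A. \<psi> (pth_root p (f a)))"
        if "\<And>a. a \<in> A \<Longrightarrow> f a \<in> ?L" for f and A :: "(nat \<Rightarrow> int) set"
        using that
      proof (induction A rule: infinite_finite_induct)
        case (insert b A)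
        have "sum f A \<in> ?L" by (rule L_sum[OF nz]) (use insert.prems in auto)
        thus ?case using insert add[of "f b" "sum f A"] by simp
      qed auto
      have Ck: "C z a \<in> K" for a using C[OF z] by (simp add: fsupp_def)
      have "\<psi> (pth_root p z) = \<psi> (pth_root p (\<Sum>a | C z a \<noteq> 0. C z a * ?M a))"
        using C[OF z] by (simp add: lcomb_def)
      also have "\<dots> = (\<Sum>a | C z a \<noteq> 0. \<psi> (pth_root p (C z a * ?M a)))"
        by (intro sum L_term nz Ck)
      also have "\<dots> = H (C z)"
        using s Ck unfolding is_standard_splitting_def Let_def H_def G_def by (intro sum.cong) auto
      finally show ?thesis .
    qed
    show ?thesis
    proof (rule PiE_ext)
      show "\<psi> \<in> pth_roots p ?L \<rightarrow>\<^sub>E ?L" "\<psi>' \<in> pth_roots p ?L \<rightarrow>\<^sub>E ?L"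
        using 1 2 by (simp_all add: is_standard_splitting_def Let_def)
      fix y assume "y \<in> pth_roots p ?L"
      then obtain z where "z \<in> ?L" "y = pth_root p z" using rootE by blast
      thus "\<psi> y = \<psi>' y" using *[OF 1] *[OF 2] by simp
    qed
  qed
  ultimately show ?thesis by blast
qed

corollary is_standard_splitting_standard_splitting:
  assumes "CHAR('f) = p" "p > 0" "frobenius_splitting p K \<phi>\<^sub>0" "algebraically_independent K n x"
  shows "is_standard_splitting K n p \<phi>\<^sub>0 x (standard_splitting K n p \<phi>\<^sub>0 x)"
  unfolding standard_splitting_def by (rule theI'[OF standard_splitting_ex1[OF assms]])

end

end

theory Submission
  imports Defs
begin

text \<open>
  Let \<open>x'\<close> be the cluster obtained from \<open>x\<close> by mutation at \<open>l\<close>, so that \<open>x\<^sub>l' = (P + M) / x\<^sub>l\<close> with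
  monomials \<open>P\<close>, \<open>M\<close> not involving \<open>x\<^sub>l\<close>. The standard splittings of both Laurent rings are linear
  with respect to \<open>p\<close>-th powers, so on a monomial in \<open>x'\<close> the exponent of \<open>x\<^sub>l'\<close> may be reduced to
  \<open>0 \<le> k < p\<close>. For \<open>k = 0\<close> the monomial is also a monomial in \<open>x\<close>. For \<open>k > 0\<close> the splitting of \<open>x'\<close>
  kills it, and so does that of \<open>x\<close>, because it is a Laurent polynomial all of whose terms have
  \<open>x\<^sub>l\<close>-exponent \<open>- k\<close>. Hence the two splittings agree on the intersection of the Laurent rings.
  Along any path of mutations, all splittings therefore agree on \<open>\<U>\<close>, and so their common
  restriction takes values in every Laurent ring, that is in \<open>\<U>\<close>.
\<close>

section \<open>Laurent monomials and the factor of one variable\<close>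

text \<open>Isolates the exchanged variable: the exponent 0 makes the first factor free of
  \<open>x l\<close>. Taking \<open>v = 1\<close> identifies that factor with a monomial in the
  remaining variables.\<close>

lemma laurent_monomial_upd:
  assumes "l \<in> {1..n}"
  shows "laurent_monomial n (x(l := v)) a = laurent_monomial n x (a(l := 0)) * v powi a l"
proof -
  have split: "laurent_monomial n y b = y l powi b l * (\<Prod>i\<in>{1..n} - {l}. y i powi b i)" for y :: "nat \<Rightarrow> 'a" and b
    unfolding laurent_monomial_def using assms by (intro prod.remove) auto
  have "(\<Prod>i\<in>{1..n} - {l}. (x(l := v)) i powi a i) = (\<Prod>i\<in>{1..n} - {l}. x i powi (a(l := 0)) i)"
    by (intro prod.cong) auto
  thus ?thesis unfolding split by simp
qed

lemma laurent_monomial_exponent_upd: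
  assumes "l \<in> {1..n}"
  shows "laurent_monomial n x (a(l := e)) = laurent_monomial n x (a(l := 0)) * x l powi e"
  using laurent_monomial_upd[OF assms, of x "x l" "a(l := e)"] by simp

lemma laurent_monomial_of_nat: "laurent_monomial n x (\<lambda>i. int (a i)) = (\<Prod>i=1..n. x i ^ a i)"
  by (simp add: laurent_monomial_def)

lemma laurent_monomial_power:
  "laurent_monomial n x a ^ k = laurent_monomial n x (\<lambda>i. int k * a i)"
  unfolding laurent_monomial_def prod_power_distrib
  by (intro prod.cong refl, subst mult.commute) (simp add: power_int_mult)

section \<open>Roots of order p in characteristic p\<close>

context
  fixes p :: nat
  assumes char: "CHAR('f::field) = p" and p_pos: "p > 0"
begin

lemma prime_char: "prime p"
  using char p_pos prime_CHAR_semidom[where 'a = 'f] by auto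

lemma add_power_char: "(u + v) ^ p = u ^ p + (v::'f) ^ p"
  by (rule freshmans_dream) (simp_all add: char prime_char)

lemma ac_add_power_char: "(u + v) ^ p = u ^ p + (v::'f alg_closure) ^ p"
  by (rule freshmans_dream) (simp_all add: char prime_char)

text \<open>Frobenius is additive, so \<open>u - v\<close> has p-th power 0. This makes the
  description operator in \<open>pth_root\<close> meaningful.\<close>

lemma ac_power_char_inj:
  fixes u v :: "'f alg_closure"
  assumes "u ^ p = v ^ p"
  shows "u = v"
proof -
  have "(u - v) ^ p = 0" using ac_add_power_char[of "u - v" v] assms by simp
  thus ?thesis using p_pos by simp
qed

lemma pth_root_power: "pth_root p (r::'f) ^ p = to_ac r"
proof -
  obtain y :: "'f alg_closure" where "y ^ p = to_ac r" using nth_root_exists[OF p_pos] by blast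
  thus ?thesis unfolding pth_root_def
    by (rule theI) (use \<open>y ^ p = to_ac r\<close> ac_power_char_inj in auto)
qed

lemma pth_rootI: "y ^ p = to_ac (r::'f) \<Longrightarrow> pth_root p r = y"
  by (rule ac_power_char_inj) (simp add: pth_root_power)

lemma pth_root_add: "pth_root p (r + s :: 'f) = pth_root p r + pth_root p s"
  by (rule pth_rootI) (simp add: ac_add_power_char pth_root_power)

text \<open>Linearity over R of a map on the p-th roots thus becomes the rule that a factor
  \<open>r ^ p\<close> under the root comes out as \<open>r\<close>; splittings are handled in this
  form below.\<close>

lemma pth_root_power_mult: "pth_root p (r ^ p * s :: 'f) = to_ac r * pth_root p s"
  by (rule pth_rootI) (simp add: power_mult_distrib pth_root_power)

lemma pth_root_in_iff: "pth_root p (r::'f) \<in> pth_roots p R \<longleftrightarrow> r \<in> R"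
  by (auto simp: pth_roots_def pth_root_power)

lemma pth_rootsE:
  assumes "y \<in> pth_roots p (R::'f set)"
  obtains r where "r \<in> R" "y = pth_root p r"
proof -
  obtain r where "r \<in> R" "y ^ p = to_ac r" using assms unfolding pth_roots_def by auto
  thus ?thesis using that pth_rootI by metis
qed

end

section \<open>Closure properties and induction for Laurent rings\<close>

context
  fixes K :: "'f::field set" and n :: nat
  assumes K: "subfield K ring_of_type_algebra"
begin

lemma laurent_ring_add:
    "u \<in> laurent_ring K n x \<Longrightarrow> v \<in> laurent_ring K n x \<Longrightarrow> u + v \<in> laurent_ring K n x"
  and laurent_ring_mult:
    "u \<in> laurent_ring K n x \<Longrightarrow> v \<in> laurent_ring K n x \<Longrightarrow> u * v \<in> laurent_ring K n x"
  and laurent_ring_1: "1 \<in> laurent_ring K n x"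
  unfolding laurent_ring_def
  using generate_ring.eng_add[of u ring_of_type_algebra _ v]
    generate_ring.eng_mult[of u ring_of_type_algebra _ v]
    generate_ring.one[of "ring_of_type_algebra :: 'f ring"]
  by (auto simp del: One_nat_def)

lemma laurent_ring_base: "c \<in> K \<Longrightarrow> c \<in> laurent_ring K n x"
  and laurent_ring_var: "i \<in> {1..n} \<Longrightarrow> x i \<in> laurent_ring K n x"
  and laurent_ring_inverse_var: "i \<in> {1..n} \<Longrightarrow> inverse (x i) \<in> laurent_ring K n x"
  unfolding laurent_ring_def by (auto intro: generate_ring.incl)

lemma laurent_ring_power: "u \<in> laurent_ring K n x \<Longrightarrow> u ^ k \<in> laurent_ring K n x"
  by (induction k) (auto intro: laurent_ring_mult laurent_ring_1)

lemma laurent_ring_sum: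
  "(\<And>i. i \<in> A \<Longrightarrow> f i \<in> laurent_ring K n x) \<Longrightarrow> sum f A \<in> laurent_ring K n x"
  by (induction A rule: infinite_finite_induct)
    (auto intro: laurent_ring_add laurent_ring_base K0[OF K])

lemma laurent_ring_monomial:
  assumes "c \<in> K"
  shows "c * laurent_monomial n x a \<in> laurent_ring K n x"
proof -
  have "x i powi a i \<in> laurent_ring K n x" if "i \<in> {1..n}" for i
    using laurent_ring_var[OF that] laurent_ring_inverse_var[OF that]
    by (auto simp: power_int_def intro: laurent_ring_power)
  hence "(\<Prod>i\<in>A. x i powi a i) \<in> laurent_ring K n x" if "A \<subseteq> {1..n}" for A
    using that
    by (induction A rule: infinite_finite_induct) (auto intro: laurent_ring_mult laurent_ring_1)
  thus ?thesis using assms unfolding laurent_monomial_def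
    by (blast intro: laurent_ring_mult laurent_ring_base)
qed

lemma algebraically_independent_nz:
  "algebraically_independent K n x \<Longrightarrow> 0 \<notin> x ` {1..n}"
  using alg_indep_nz[OF K] by (metis imageE)

lemma laurent_monomial_add:
  fixes x :: "nat \<Rightarrow> 'f"
  assumes "0 \<notin> x ` {1..n}"
  shows "laurent_monomial n x (\<lambda>i. a i + b i) = laurent_monomial n x a * laurent_monomial n x b"
  by (rule monomial_add[OF K, of n x a b]) (use assms in force)

text \<open>An element is a finite sum of terms, built up one term at a time; the empty sum is the
  term with coefficient 0.\<close>

lemma laurent_ring_induct [consumes 2, case_names monom add]:
  assumes z: "z \<in> laurent_ring K n x" and nz: "0 \<notin> x ` {1..n}"
    and monom: "\<And>c a. c \<in> K \<Longrightarrow> P (c * laurent_monomial n x a)"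
    and add: "\<And>u v. u \<in> laurent_ring K n x \<Longrightarrow> v \<in> laurent_ring K n x \<Longrightarrow> P u \<Longrightarrow> P v \<Longrightarrow> P (u + v)"
  shows "P z"
proof -
  obtain c where c: "fsupp K n c" "z = lcomb n x c"
    using z nz laurent_ring_subset[OF K, of n x] by (fastforce simp: lspan_def)
  have cK: "c a \<in> K" for a using c(1) by (simp add: fsupp_def)
  \<comment> \<open>Membership is proved alongside \<open>P\<close>, since \<open>add\<close>
    demands it of both summands.\<close>
  have "sum (\<lambda>a. c a * laurent_monomial n x a) A \<in> laurent_ring K n x
      \<and> P (sum (\<lambda>a. c a * laurent_monomial n x a) A)" for A
  proof (induction A rule: infinite_finite_induct)
    case (insert b A)
    thus ?case
      using add[OF laurent_ring_monomial[OF cK[of b], of x b]]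
        laurent_ring_add[OF laurent_ring_monomial[OF cK[of b], of x b]]
        monom[OF cK[of b], of b] by simp
  qed (use monom[OF K0[OF K], of "\<lambda>_. 0"] laurent_ring_base[OF K0[OF K]] in auto)
  thus ?thesis unfolding c(2) lcomb_def by blast
qed

(* Setting the variable at l to 1 turns the Laurent ring of x into that of the other variables. *)
lemma laurent_ring_upd_1E:
  assumes l: "l \<in> {1..n}" and nz: "0 \<notin> x ` {1..n}"
    and z: "z \<in> laurent_ring K n (x(l := 1))"
  shows "\<exists>c. fsupp K n c \<and> (\<forall>a. c a \<noteq> 0 \<longrightarrow> a l = 0) \<and> z = lcomb n x c"
proof -
  have "0 \<notin> (x(l := 1)) ` {1..n}" using nz by auto
  with z show ?thesis
  proof (induction rule: laurent_ring_induct)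
    case (monom c a)
    show ?case
      using single[OF K monom, where a = "a(l := 0)" and n = n] laurent_monomial_upd[OF l, of x 1 a]
      by (intro exI[of _ "\<lambda>b. if b = (\<lambda>i. if i \<in> {1..n} then (a(l := 0)) i else 0) then c else 0"]) auto
  next
    case (add u v)
    then obtain c d where c: "fsupp K n c" "\<forall>a. c a \<noteq> 0 \<longrightarrow> a l = 0" "u = lcomb n x c"
      and d: "fsupp K n d" "\<forall>a. d a \<noteq> 0 \<longrightarrow> a l = 0" "v = lcomb n x d" by auto
    have "a l = 0" if "c a + d a \<noteq> 0" for a
      using c(2) d(2) that by (cases "c a = 0") auto
    thus ?case
      using fsupp_add[OF K c(1) d(1)] lcomb_add[OF K c(1) d(1), of x] unfolding c(3) d(3)
      by (intro exI[of _ "\<lambda>a. c a + d a"] conjI allI impI) (assumption | simp)+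
  qed
qed

section \<open>Algebraic independence of an exchanged cluster\<close>

text \<open>Each \<open>u k\<close> expands into monomials free of \<open>x l\<close>, so the
  summand of index \<open>k\<close> has only monomials of exponent \<open>k\<close> at
  \<open>l\<close>. Different \<open>k\<close> share no monomial, and the whole sum is a single
  Laurent combination whose coefficients must vanish.\<close>

lemma laurent_variable_independent:
  assumes l: "l \<in> {1..n}" and ind: "algebraically_independent K n x"
    and A: "finite A" and u: "\<And>k. k \<in> A \<Longrightarrow> u k \<in> laurent_ring K n (x(l := 1))"
    and eq: "(\<Sum>k\<in>A. u k * x l powi k) = 0" and k: "k \<in> A"
  shows "u k = 0"
proof -
  note nz = algebraically_independent_nz[OF ind]
  obtain C where C: "\<And>k. k \<in> A \<Longrightarrow> fsupp K n (C k) \<and> (\<forall>a. C k a \<noteq> 0 \<longrightarrow> a l = 0) \<and> u k = lcomb n x (C k)"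
    using laurent_ring_upd_1E[OF l nz u] by metis
  \<comment> \<open>The coefficients of the whole sum: the exponent at \<open>l\<close> selects the
    summand, and erasing it gives the monomial in \<open>u (a l)\<close>. The exponents contributed
    by summand \<open>k\<close> form \<open>B k\<close>.\<close>
  define c where "c = (\<lambda>a. if a l \<in> A then C (a l) (a(l := 0)) else 0)"
  define B where "B = (\<lambda>k. (\<lambda>a. a(l := k)) ` {a. C k a \<noteq> 0})"
  have B: "finite (B k)" if "k \<in> A" for k using C[OF that] by (simp add: B_def fsupp_def)
  have supp: "{a. c a \<noteq> 0} = (\<Union>k\<in>A. B k)"
  proof (intro equalityI subsetI)
    fix a assume "a \<in> {a. c a \<noteq> 0}"
    hence "a l \<in> A" "C (a l) (a(l := 0)) \<noteq> 0" by (auto simp: c_def split: if_splits)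
    moreover have "a = (a(l := 0))(l := a l)" by simp
    ultimately show "a \<in> (\<Union>k\<in>A. B k)" unfolding B_def by blast
  next
    fix a assume "a \<in> (\<Union>k\<in>A. B k)"
    then obtain k b where k: "k \<in> A" "C k b \<noteq> 0" "a = b(l := k)" by (auto simp: B_def)
    moreover from k C have "b(l := 0) = b" by auto
    ultimately show "a \<in> {a. c a \<noteq> 0}" by (simp add: c_def)
  qed
  have fs: "fsupp K n c"
    unfolding fsupp_def
  proof (intro conjI allI impI)
    show "finite {a. c a \<noteq> 0}" unfolding supp using A B by blast
    show "c a \<in> K" for a using C by (auto simp: c_def fsupp_def K0[OF K])
    fix a i assume a: "c a \<noteq> 0" and i: "i \<notin> {1..n}"
    hence "a l \<in> A" "C (a l) (a(l := 0)) \<noteq> 0" by (auto simp: c_def split: if_splits)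
    hence "(a(l := 0)) i = 0" using C i unfolding fsupp_def by blast
    thus "a i = 0" using i l by (auto split: if_splits)
  qed
  have part: "(\<Sum>a\<in>B k. c a * laurent_monomial n x a) = u k * x l powi k" if k: "k \<in> A" for k
  proof -
    have idem: "b(l := 0) = b" if "C k b \<noteq> 0" for b using C[OF k] that by auto
    have inj: "inj_on (\<lambda>a. a(l := k)) {a. C k a \<noteq> 0}"
      by (rule inj_on_inverseI[where g = "\<lambda>a. a(l := 0)"]) (use idem in auto)
    show ?thesis
      unfolding B_def sum.reindex[OF inj] using C[OF k] idem k
      by (simp add: c_def lcomb_def sum_distrib_right laurent_monomial_exponent_upd[OF l, of x _ k] mult.assoc)
  qed
  have "lcomb n x c = (\<Sum>k\<in>A. \<Sum>a\<in>B k. c a * laurent_monomial n x a)"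
    unfolding lcomb_def supp
  proof (rule sum.UNION_disjoint)
    show "\<forall>i\<in>A. \<forall>j\<in>A. i \<noteq> j \<longrightarrow> B i \<inter> B j = {}"
    proof (intro ballI impI)
      have B_l: "a l = i" if "a \<in> B i" for a i using that by (auto simp: B_def)
      show "B i \<inter> B j = {}" if "i \<noteq> j" for i j using B_l that by blast
    qed
  qed (use A B in auto)
  also have "\<dots> = 0" using part eq by simp
  finally have c0: "c a = 0" for a using lcomb_0[OF K ind fs] by blast
  have "C k a = 0" for a
  proof (rule ccontr)
    assume a: "C k a \<noteq> 0"
    hence "a(l := 0) = a" using C[OF k] by auto
    thus False using c0[of "a(l := k)"] a k by (simp add: c_def)
  qed
  thus ?thesis using C[OF k] by (simp add: lcomb_def)
qed

text \<open>Distinct monomials are linearly independent. Equal ones would cancel in characteristic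
  2, hence the differing exponent at \<open>j\<close>.\<close>

lemma laurent_monomial_sum_nz:
  assumes ind: "algebraically_independent K n x" and j: "j \<in> {1..n}" "a j \<noteq> b j"
  shows "laurent_monomial n x a + laurent_monomial n x b \<noteq> 0"
proof
  assume eq: "laurent_monomial n x a + laurent_monomial n x b = 0"
  \<comment> \<open>\<open>fsupp\<close> wants exponents to vanish outside \<open>{1..n}\<close>,
    which \<open>r\<close> enforces; \<open>f a\<close> is then the coefficient function of the
    monomial of \<open>a\<close>.\<close>
  define r where "r = (\<lambda>a i. if i \<in> {1..n} then a i else (0::int))"
  define f where "f = (\<lambda>a b. if b = r a then 1 else (0::'f))"
  have f: "fsupp K n (f a)" "lcomb n x (f a) = laurent_monomial n x a" for a
    using single(1)[OF K K1[OF K], of n a] single(2)[OF K K1[OF K], of n x a]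
    unfolding f_def r_def mult_1 by blast+
  have "r a j \<noteq> r b j" using j by (simp add: r_def)
  hence "r a \<noteq> r b" by metis
  moreover have "f a (r a) + f b (r a) = 0"
    using lcomb_0[OF K ind fsupp_add[OF K f(1) f(1)]] lcomb_add[OF K f(1) f(1)] f(2) eq by simp
  ultimately show False by (simp add: f_def)
qed

text \<open>Substitute \<open>w / x l\<close> into a polynomial relation and sort by powers of
  \<open>x l\<close>. The coefficient of each power vanishes, and cancelling the power of
  \<open>w\<close> leaves relations among the old variables.\<close>

lemma algebraically_independent_exchange:
  assumes l: "l \<in> {1..n}" and ind: "algebraically_independent K n x"
    and w: "w \<in> laurent_ring K n (x(l := 1))" "w \<noteq> 0"
  shows "algebraically_independent K n (x(l := w * inverse (x l)))"
  unfolding algebraically_independent_def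
proof (intro allI impI, elim conjE)
  fix P :: "(nat \<Rightarrow>\<^sub>0 nat) \<Rightarrow>\<^sub>0 'f"
  let ?l = "Poly_Mapping.lookup"
  let ?B = "Poly_Mapping.keys P"
  let ?x' = "x(l := w * inverse (x l))"
  assume P: "\<forall>m\<in>?B. Poly_Mapping.keys m \<subseteq> {1..n} \<and> ?l P m \<in> K"
    and eq: "(\<Sum>m\<in>?B. ?l P m * (\<Prod>i=1..n. ?x' i ^ ?l m i)) = 0"
  note nz = algebraically_independent_nz[OF ind]
  have nz1: "0 \<notin> (x(l := 1)) ` {1..n}" using nz by auto
  \<comment> \<open>The new variable has \<open>x l\<close> in its denominator, so its exponent
    reappears negated as an exponent of \<open>x l\<close>. The part of the monomial away from
    \<open>l\<close> is \<open>r m\<close>, and \<open>Q k\<close> collects the terms with exponent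
    \<open>k\<close>.\<close>
  let ?e = "\<lambda>m. - int (?l m l)"
  define r where "r = (\<lambda>m. laurent_monomial n x ((\<lambda>i. int (?l m i))(l := 0)))"
  define Q where "Q = (\<lambda>k. \<Sum>m\<in>{m\<in>?B. ?e m = k}. ?l P m * r m)"
  have "?l P m * r m \<in> laurent_ring K n (x(l := 1))" if "m \<in> ?B" for m
    using laurent_ring_monomial[of "?l P m" "x(l := 1)" "\<lambda>i. int (?l m i)"] laurent_monomial_upd[OF l, of x 1] P that
    by (simp add: r_def)
  hence Q: "Q k \<in> laurent_ring K n (x(l := 1))" for k
    unfolding Q_def by (intro laurent_ring_sum) auto
  have mono': "(\<Prod>i=1..n. ?x' i ^ ?l m i) = r m * w ^ ?l m l * x l powi ?e m" for m
    using laurent_monomial_of_nat[of n ?x' "?l m"]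
      laurent_monomial_upd[OF l, of x "w * inverse (x l)" "\<lambda>i. int (?l m i)"] nz l
    by (simp add: r_def power_mult_distrib power_int_minus power_inverse mult.assoc)
  have mono: "(\<Prod>i=1..n. x i ^ ?l m i) = r m * x l ^ ?l m l" for m
    using laurent_monomial_of_nat[of n x "?l m"]
      laurent_monomial_upd[OF l, of x "x l" "\<lambda>i. int (?l m i)"] by (simp add: r_def)
  have "(\<Sum>k\<in>?e ` ?B. Q k * w ^ nat (- k) * x l powi k) =
      (\<Sum>k\<in>?e ` ?B. \<Sum>m\<in>{m\<in>?B. ?e m = k}. ?l P m * (\<Prod>i=1..n. ?x' i ^ ?l m i))"
    unfolding Q_def sum_distrib_right mono' by (intro sum.cong refl) (auto simp: mult_ac)
  also have "\<dots> = (\<Sum>m\<in>?B. ?l P m * (\<Prod>i=1..n. ?x' i ^ ?l m i))"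
    by (rule sum.image_gen[symmetric]) simp
  finally have sum0: "(\<Sum>k\<in>?e ` ?B. Q k * w ^ nat (- k) * x l powi k) = 0" using eq by simp
  have Q0: "Q k = 0" if "k \<in> ?e ` ?B" for k
    using laurent_variable_independent[OF l ind _ _ sum0 that] w(2)
      laurent_ring_mult[OF Q laurent_ring_power[OF w(1)]] by simp
  have "?l P m = 0" if m: "m \<in> ?B" for m
  proof -
    let ?C = "{m'\<in>?B. ?e m' = ?e m}"
    \<comment> \<open>All monomials in \<open>?C\<close> have the same exponent at \<open>l\<close>,
      so multiplying \<open>Q\<close> by that power of \<open>x l\<close> gives a genuine polynomial
      in \<open>x\<close>.\<close>
    have "(\<Sum>m'\<in>?C. ?l P m' * (\<Prod>i=1..n. x i ^ ?l m' i)) = Q (?e m) * x l ^ ?l m l"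
      unfolding Q_def sum_distrib_right mono by (intro sum.cong refl) (auto simp: mult_ac)
    hence "(\<Sum>m'\<in>?C. ?l P m' * (\<Prod>i=1..n. x i ^ ?l m' i)) = 0" using Q0 m by simp
    from alg_indep_finite[OF K ind _ _ _ this] show ?thesis using P m by auto
  qed
  thus "P = 0" by (intro poly_mapping_eqI) (metis in_keys_iff lookup_zero)
qed

section \<open>Standard splittings of a Laurent ring\<close>

context
  fixes p :: nat and \<phi>\<^sub>0 :: "'f alg_closure \<Rightarrow> 'f"
  assumes char: "CHAR('f) = p" and p_pos: "p > 0" and split0: "frobenius_splitting p K \<phi>\<^sub>0"
begin

context
  fixes x :: "nat \<Rightarrow> 'f" and \<phi> :: "'f alg_closure \<Rightarrow> 'f"
  assumes std: "is_standard_splitting K n p \<phi>\<^sub>0 x \<phi>" and nz: "0 \<notin> x ` {1..n}"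
begin

lemma standard_splitting_in: "z \<in> laurent_ring K n x \<Longrightarrow> \<phi> (pth_root p z) \<in> laurent_ring K n x"
  using std pth_root_in_iff[OF char p_pos] unfolding is_standard_splitting_def Let_def
  by (meson PiE_mem)

lemma standard_splitting_add:
  "u \<in> laurent_ring K n x \<Longrightarrow> v \<in> laurent_ring K n x \<Longrightarrow>
    \<phi> (pth_root p (u + v)) = \<phi> (pth_root p u) + \<phi> (pth_root p v)"
  using std unfolding is_standard_splitting_def Let_def
  by (simp add: pth_root_in_iff[OF char p_pos] pth_root_add[OF char p_pos])

lemma standard_splitting_monomial:
  "c \<in> K \<Longrightarrow> \<phi> (pth_root p (c * laurent_monomial n x a)) =
    (if \<forall>i\<in>{1..n}. int p dvd a i
     then \<phi>\<^sub>0 (pth_root p c) * laurent_monomial n x (\<lambda>i. a i div int p) else 0)"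
  using std unfolding is_standard_splitting_def Let_def by blast

text \<open>The factor \<open>r ^ p\<close> shifts exponents by multiples of \<open>p\<close>:
  divisibility is unaffected and the quotients shift by \<open>a\<close>. The scalar
  \<open>c ^ p\<close> leaves the root as \<open>c\<close> by linearity of
  \<open>\<phi>\<^sub>0\<close>.\<close>

lemma standard_splitting_monomial_power_mult:
  fixes a :: "nat \<Rightarrow> int"
  assumes c: "c \<in> K" and z: "z \<in> laurent_ring K n x"
  defines "r \<equiv> c * laurent_monomial n x a"
  shows "\<phi> (pth_root p (r ^ p * z)) = r * \<phi> (pth_root p z)"
  using z nz
proof (induction rule: laurent_ring_induct)
  case (monom d b)
  have eq: "r ^ p * (d * laurent_monomial n x b) = (c ^ p * d) * laurent_monomial n x (\<lambda>i. int p * a i + b i)"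
    using laurent_monomial_add[OF nz, of "\<lambda>i. int p * a i" b]
    by (simp add: r_def power_mult_distrib laurent_monomial_power mult_ac)
  have cp: "c ^ k \<in> K" for k using c by (induction k) (auto simp: K1[OF K] Kmult[OF K])
  have \<phi>\<^sub>0: "\<phi>\<^sub>0 (pth_root p (c ^ p * d)) = c * \<phi>\<^sub>0 (pth_root p d)"
    using split0 c monom
    by (simp add: pth_root_power_mult[OF char p_pos] frobenius_splitting_def pth_root_in_iff[OF char p_pos])
  have "laurent_monomial n x (\<lambda>i. (int p * a i + b i) div int p)
      = laurent_monomial n x a * laurent_monomial n x (\<lambda>i. b i div int p)"
    using laurent_monomial_add[OF nz, of a "\<lambda>i. b i div int p"] p_pos by simp
  thus ?case
    using standard_splitting_monomial[OF Kmult[OF K cp[of p] monom], of "\<lambda>i. int p * a i + b i"]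
      standard_splitting_monomial[OF monom, of b] \<phi>\<^sub>0
    unfolding eq by (simp add: dvd_add_right_iff r_def mult_ac)
next
  case (add u v)
  have "r ^ p \<in> laurent_ring K n x" unfolding r_def by (intro laurent_ring_power laurent_ring_monomial c)
  thus ?case
    using add standard_splitting_add[of u v] standard_splitting_add[of "r ^ p * u" "r ^ p * v"]
    by (simp add: distrib_left laurent_ring_mult)
qed

text \<open>Both sides are additive in \<open>r\<close>, because
  \<open>(u + v) ^ p = u ^ p + v ^ p\<close>; this reduces the claim to a single term
  \<open>r\<close>.\<close>

lemma standard_splitting_power_mult:
  assumes r: "r \<in> laurent_ring K n x" and z: "z \<in> laurent_ring K n x"
  shows "\<phi> (pth_root p (r ^ p * z)) = r * \<phi> (pth_root p z)"
  using r nz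
proof (induction rule: laurent_ring_induct)
  case (monom c a)
  thus ?case using standard_splitting_monomial_power_mult z by blast
next
  case (add u v)
  thus ?case
    using standard_splitting_add[of "u ^ p * z" "v ^ p * z"] z
    by (simp add: add_power_char[OF char p_pos] distrib_right laurent_ring_mult laurent_ring_power)
qed

lemma standard_splitting_1: "\<phi> (pth_root p 1) = 1"
proof -
  have "pth_root p (1::'f) = 1" by (rule pth_rootI[OF char p_pos]) simp
  thus ?thesis
    using standard_splitting_monomial[OF K1[OF K], of "\<lambda>_. 0"] split0
    by (simp add: laurent_monomial_def frobenius_splitting_def)
qed

text \<open>Every term of \<open>u * x l powi e\<close> has exponent \<open>e\<close> at
  \<open>l\<close>, so the splitting kills each of them.\<close>

lemma standard_splitting_eq_0:
  assumes l: "l \<in> {1..n}" and u: "u \<in> laurent_ring K n (x(l := 1))" and e: "\<not> int p dvd e"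
  shows "\<phi> (pth_root p (u * x l powi e)) = 0"
proof -
  have nz1: "0 \<notin> (x(l := 1)) ` {1..n}" using nz by auto
  have "u * x l powi e \<in> laurent_ring K n x \<and> \<phi> (pth_root p (u * x l powi e)) = 0"
    using u nz1
  proof (induction rule: laurent_ring_induct)
    case (monom c a)
    have eq: "c * laurent_monomial n (x(l := 1)) a * x l powi e = c * laurent_monomial n x (a(l := e))"
      using laurent_monomial_upd[OF l, of x 1 a] laurent_monomial_exponent_upd[OF l, of x a e] by simp
    have "\<not> (\<forall>i\<in>{1..n}. int p dvd (a(l := e)) i)" using l e by auto
    hence "\<phi> (pth_root p (c * laurent_monomial n x (a(l := e)))) = 0"
      unfolding standard_splitting_monomial[OF monom] by (rule if_not_P)
    thus ?case unfolding eq using laurent_ring_monomial[OF monom] by blast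
  next
    case (add u v)
    thus ?case
      using standard_splitting_add[of "u * x l powi e" "v * x l powi e"] laurent_ring_add
      by (simp add: distrib_right)
  qed
  thus ?thesis ..
qed

text \<open>Additivity, linearity and the value at 1 are inherited from the Laurent ring; only
  stability of \<open>R\<close> has to be supplied.\<close>

lemma standard_splitting_restricts:
  assumes R: "R \<subseteq> laurent_ring K n x" "\<And>u. u \<in> R \<Longrightarrow> \<phi> (pth_root p u) \<in> R"
  shows "frobenius_splitting p R \<phi>"
  unfolding frobenius_splitting_def
proof (intro conjI ballI)
  show "\<phi> \<in> pth_roots p R \<rightarrow> R" using R(2) by (auto elim: pth_rootsE[OF char p_pos])
next
  fix y z assume "y \<in> pth_roots p R" "z \<in> pth_roots p R"
  then obtain u v where "u \<in> R" "v \<in> R" "y = pth_root p u" "z = pth_root p v"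
    by (meson pth_rootsE[OF char p_pos])
  thus "\<phi> (y + z) = \<phi> y + \<phi> z"
    using standard_splitting_add[of u v] R(1) by (auto simp: pth_root_add[OF char p_pos])
next
  fix r y assume "r \<in> R" "y \<in> pth_roots p R"
  then obtain u where "u \<in> R" "y = pth_root p u" by (meson pth_rootsE[OF char p_pos])
  thus "\<phi> (to_ac r * y) = r * \<phi> y"
    using standard_splitting_power_mult[of r u] R(1) \<open>r \<in> R\<close>
    by (auto simp: pth_root_power_mult[OF char p_pos])
next
  have "pth_root p (1::'f) = 1" by (rule pth_rootI[OF char p_pos]) simp
  thus "\<phi> 1 = 1" using standard_splitting_1 by simp
qed

end

section \<open>Agreement of the splittings of adjacent clusters\<close>

text \<open>The new variable lies in both Laurent rings, but its inverse need not lie in the old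
  one. Hence \<open>z\<close> is first multiplied by a p-th power of the new variable that clears
  its negative exponents, and this power is cancelled at the end.\<close>

lemma standard_splitting_exchange:
  fixes x w l
  defines "x' \<equiv> x(l := w * inverse (x l))"
  assumes l: "l \<in> {1..n}" and nz: "0 \<notin> x ` {1..n}"
    and w: "w \<in> laurent_ring K n (x(l := 1))" "w \<noteq> 0"
    and \<phi>: "is_standard_splitting K n p \<phi>\<^sub>0 x \<phi>" and \<psi>: "is_standard_splitting K n p \<phi>\<^sub>0 x' \<psi>"
    and z: "z \<in> laurent_ring K n x" "z \<in> laurent_ring K n x'"
  shows "\<phi> (pth_root p z) = \<psi> (pth_root p z)"
proof -
  have nz1: "0 \<notin> (x(l := 1)) ` {1..n}" using nz by auto
  have nz': "0 \<notin> x' ` {1..n}" using nz w(2) l by (auto simp: x'_def)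
  have x'_1: "x'(l := 1) = x(l := 1)" by (simp add: x'_def)
  define G where "G = {u \<in> laurent_ring K n x \<inter> laurent_ring K n x'. \<phi> (pth_root p u) = \<psi> (pth_root p u)}"
  have G_add: "u + v \<in> G" if "u \<in> G" "v \<in> G" for u v
    using that standard_splitting_add[OF \<phi> nz, of u v] standard_splitting_add[OF \<psi> nz', of u v]
      laurent_ring_add[of u x v] laurent_ring_add[of u x' v] by (simp add: G_def)
  have incl: "laurent_ring K n (x(l := 1)) \<subseteq> laurent_ring K n x \<inter> laurent_ring K n x'"
  proof
    fix u assume "u \<in> laurent_ring K n (x(l := 1))"
    from this nz1 show "u \<in> laurent_ring K n x \<inter> laurent_ring K n x'"
    proof (induction rule: laurent_ring_induct)
      case (monom c a)
      show ?case
        using laurent_ring_monomial[OF monom, of x "a(l := 0)"] laurent_ring_monomial[OF monom, of x' "a(l := 0)"]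
          laurent_monomial_upd[OF l, of x 1 a] laurent_monomial_upd[OF l, of x' 1 a] x'_1 by simp
    qed (use laurent_ring_add in auto)
  qed
  have y': "x' l \<in> laurent_ring K n x'" by (rule laurent_ring_var[OF l])
  have y'_nz: "x' l \<noteq> 0" using nz' l by auto
  have y: "x' l \<in> laurent_ring K n x"
    using w(1) incl laurent_ring_mult[OF _ laurent_ring_inverse_var[OF l], of w x] by (auto simp: x'_def)
  have G_power_mult: "u \<in> G \<Longrightarrow> (x' l ^ q) ^ p * u \<in> G" for q u
    using standard_splitting_power_mult[OF \<phi> nz laurent_ring_power[OF y], of u q]
      standard_splitting_power_mult[OF \<psi> nz' laurent_ring_power[OF y'], of u q]
    by (simp add: G_def laurent_ring_mult laurent_ring_power laurent_ring_mult laurent_ring_power y y')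
  have reduced: "c * laurent_monomial n (x(l := 1)) a * x' l ^ k \<in> G" if c: "c \<in> K" and k: "k < p" for c a k
  proof -
    let ?v = "c * laurent_monomial n (x(l := 1)) a"
    have v: "?v \<in> laurent_ring K n (x(l := 1))" by (rule laurent_ring_monomial[OF c])
    hence "?v \<in> laurent_ring K n x" "?v \<in> laurent_ring K n x'" using incl by auto
    hence in_L: "?v * x' l ^ k \<in> laurent_ring K n x" "?v * x' l ^ k \<in> laurent_ring K n x'"
      using laurent_ring_mult[OF _ laurent_ring_power[OF y]] laurent_ring_mult[OF _ laurent_ring_power[OF y']] by auto
    have "\<phi> (pth_root p (?v * x' l ^ k)) = \<psi> (pth_root p (?v * x' l ^ k))"
    proof (cases "k = 0")
      case True
      have eq: "laurent_monomial n x (b(l := 0)) = laurent_monomial n x' (b(l := 0))" for b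
        using laurent_monomial_upd[OF l, of x 1 b] laurent_monomial_upd[OF l, of x' 1 b] x'_1 by simp
      \<comment> \<open>As \<open>0 div p = 0\<close>, the values of the two splittings are again
        free of the variable at \<open>l\<close>, so they too are the same monomial.\<close>
      have "(\<lambda>i. (a(l := 0)) i div int p) = (\<lambda>i. a i div int p)(l := 0)" by auto
      thus ?thesis
        using standard_splitting_monomial[OF \<phi> nz c, of "a(l := 0)"]
          standard_splitting_monomial[OF \<psi> nz' c, of "a(l := 0)"]
          laurent_monomial_upd[OF l, of x 1 a] eq[of a] eq[of "\<lambda>i. a i div int p"] True by simp
    next
      case False
      have nd: "\<not> int p dvd int k" using k False by (simp add: nat_dvd_not_less)
      have eq: "?v * x' l ^ k = (?v * w ^ k) * x l powi (- int k)"
        by (simp add: x'_def power_mult_distrib power_int_minus power_inverse)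
      have "\<phi> (pth_root p (?v * x' l ^ k)) = 0"
        unfolding eq using nd
        by (intro standard_splitting_eq_0[OF \<phi> nz l] laurent_ring_mult[OF v] laurent_ring_power[OF w(1)]) simp
      moreover have "\<psi> (pth_root p (?v * x' l ^ k)) = 0"
        using standard_splitting_eq_0[OF \<psi> nz' l, of ?v "int k"] v nd x'_1 by simp
      ultimately show ?thesis by simp
    qed
    thus ?thesis using in_L by (simp add: G_def)
  qed
  \<comment> \<open>Asking for all large \<open>M\<close> lets two summands use a common
    exponent.\<close>
  have "\<exists>N. \<forall>M\<ge>N. (x' l ^ M) ^ p * z \<in> G"
    using z(2) nz'
  proof (induction rule: laurent_ring_induct)
    case (monom c a)
    have "(x' l ^ M) ^ p * (c * laurent_monomial n x' a) \<in> G" if M: "M \<ge> nat (- a l)" for M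
    proof -
      \<comment> \<open>The total exponent of \<open>x' l\<close>; it is nonnegative because
        \<open>M\<close> is at least \<open>- a l\<close> and \<open>p\<close> at least 1. Division
        by \<open>p\<close> splits off a p-th power and leaves an exponent below \<open>p\<close>,
        as in \<open>reduced\<close>.\<close>
      define e where "e = nat (int (M * p) + a l)"
      have "int M * 1 \<le> int M * int p" using p_pos by (intro mult_left_mono) auto
      hence "int e = int (M * p) + a l" using M by (simp add: e_def)
      hence "x' l ^ e = x' l ^ (M * p) * x' l powi a l"
        using power_int_add[of "x' l" "int (M * p)" "a l"] y'_nz by (metis power_int_of_nat)
      moreover have "x' l ^ e = (x' l ^ (e div p)) ^ p * x' l ^ (e mod p)"
        by (simp add: power_mult[symmetric] power_add[symmetric] div_mult_mod_eq)
      moreover have "laurent_monomial n x' a = laurent_monomial n (x(l := 1)) a * x' l powi a l"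
        using laurent_monomial_upd[OF l, of x' "x' l" a] laurent_monomial_upd[OF l, of x' 1 a] x'_1 by simp
      ultimately have eq: "(x' l ^ M) ^ p * (c * laurent_monomial n x' a)
          = (x' l ^ (e div p)) ^ p * (c * laurent_monomial n (x(l := 1)) a * x' l ^ (e mod p))"
        by (simp add: power_mult[symmetric] mult_ac)
      show ?thesis unfolding eq by (intro G_power_mult reduced monom) (simp add: p_pos)
    qed
    thus ?case by blast
  next
    case (add u v)
    then obtain N1 N2 where "\<forall>M\<ge>N1. (x' l ^ M) ^ p * u \<in> G" "\<forall>M\<ge>N2. (x' l ^ M) ^ p * v \<in> G" by blast
    thus ?case using G_add by (intro exI[of _ "max N1 N2"]) (simp add: distrib_left)
  qed
  then obtain N where "(x' l ^ N) ^ p * z \<in> G" by blast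
  hence "x' l ^ N * \<phi> (pth_root p z) = x' l ^ N * \<psi> (pth_root p z)"
    using standard_splitting_power_mult[OF \<phi> nz laurent_ring_power[OF y] z(1), of N]
      standard_splitting_power_mult[OF \<psi> nz' laurent_ring_power[OF y'] z(2), of N] by (simp add: G_def)
  thus ?thesis using y'_nz by simp
qed

end

end

(* is_seed without the conditions whose invariance under mutation the argument can do without. *)
definition is_preseed :: "'f::field set \<Rightarrow> nat \<Rightarrow> 'f seed \<Rightarrow> bool" where
  "is_preseed K n S \<longleftrightarrow>
     (\<forall>i j. arrows S i j \<noteq> 0 \<longrightarrow> i \<in> {1..n} \<and> j \<in> {1..n}) \<and>
     (\<forall>i. arrows S i i = 0) \<and>
     (\<forall>i j. arrows S i j = 0 \<or> arrows S j i = 0) \<and>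
     algebraically_independent K n (cluster S) \<and>
     (\<forall>i \<in> {1..n}. (\<forall>j. arrows S i j = 0 \<and> arrows S j i = 0) \<longrightarrow> i \<in> frozen S)"

section \<open>Exchange binomials and invariance under mutation\<close>

definition exchange_binomial :: "nat \<Rightarrow> nat \<Rightarrow> 'f::field seed \<Rightarrow> 'f" where
  "exchange_binomial n l S =
     (\<Prod>i=1..n. cluster S i ^ arrows S i l) + (\<Prod>i=1..n. cluster S i ^ arrows S l i)"

lemma cluster_mutate:
  "cluster (mutate n l S) = (cluster S)(l := exchange_binomial n l S * inverse (cluster S l))"
  by (simp add: mutate_def exchange_binomial_def)

text \<open>A mutable vertex touches some arrow, and without 2-cycles the arrows to and from its
  other end \<open>j\<close> differ in number. So the two monomials are distinct.\<close>

lemma exchange_binomial_nz: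
  assumes K: "subfield K ring_of_type_algebra" and S: "is_preseed K n S" and l: "l \<in> {1..n} - frozen S"
  shows "exchange_binomial n l S \<noteq> 0"
proof -
  obtain j where j: "arrows S l j \<noteq> 0 \<or> arrows S j l \<noteq> 0"
    using S l unfolding is_preseed_def by blast
  hence "j \<in> {1..n}" "int (arrows S j l) \<noteq> int (arrows S l j)"
    using S unfolding is_preseed_def by (blast, metis of_nat_eq_iff)
  thus ?thesis
    using laurent_monomial_sum_nz[OF K, of n "cluster S" j "\<lambda>i. int (arrows S i l)" "\<lambda>i. int (arrows S l i)"] S
    by (simp add: laurent_monomial_of_nat exchange_binomial_def is_preseed_def)
qed

text \<open>There is no loop at \<open>l\<close>, so neither monomial involves the variable at
  \<open>l\<close>.\<close>

lemma exchange_binomial_in: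
  assumes K: "subfield K ring_of_type_algebra" and S: "is_preseed K n S" and l: "l \<in> {1..n}"
  shows "exchange_binomial n l S \<in> laurent_ring K n ((cluster S)(l := 1))"
proof -
  let ?x = "cluster S"
  have "(\<Prod>i=1..n. ?x i ^ q i) \<in> laurent_ring K n (?x(l := 1))" if "q l = 0" for q
    using laurent_ring_monomial[OF K K1[OF K], of n "?x(l := 1)" "\<lambda>i. int (q i)"] laurent_monomial_of_nat[of n ?x q]
      laurent_monomial_upd[OF l, of ?x "?x l" "\<lambda>i. int (q i)"]
      laurent_monomial_upd[OF l, of ?x 1 "\<lambda>i. int (q i)"] that by simp
  thus ?thesis
    using S unfolding exchange_binomial_def is_preseed_def by (intro laurent_ring_add[OF K]) auto
qed

text \<open>Ensures that the convention on isolated vertices survives mutation. A vertex isolated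
  afterwards had no arrow to or from \<open>l\<close>, since those are merely reversed; hence it
  gained no composites either.\<close>

lemma arrows_mutate_isolated:
  assumes "\<And>i. arrows S i i = 0" "\<And>i j. arrows S i j = 0 \<or> arrows S j i = 0"
    and iso: "\<And>j. arrows (mutate n l S) i j = 0 \<and> arrows (mutate n l S) j i = 0"
  shows "arrows S i j = 0 \<and> arrows S j i = 0"
proof -
  let ?q = "arrows S"
  have q': "arrows (mutate n l S) i j =
      (let r = reverse_at l (add_composites l ?q) in r i j - min (r i j) (r j i))" for i j
    by (simp add: mutate_def cancel_2_cycles_def Let_def)
  \<comment> \<open>Without a loop at \<open>l\<close> no composite is added there, and without
    2-cycles nothing is cancelled.\<close>
  have at_l: "arrows (mutate n l S) i l = ?q l i" "arrows (mutate n l S) l i = ?q i l" for i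
    using assms(1)[of l] assms(2)[of i l]
    by (auto simp: q' Let_def reverse_at_def add_composites_def)
  show ?thesis
  proof (cases "i = l \<or> j = l")
    case True
    thus ?thesis using iso[of j] at_l[of i] at_l[of j] by auto
  next
    case False
    have "?q i l = 0" "?q l i = 0" using iso[of l] at_l[of i] by auto
    \<comment> \<open>Cancellation could now hide only a 2-cycle already present in
      \<open>S\<close>, and there is none.\<close>
    thus ?thesis using False iso[of j] assms(2)[of i j]
      by (auto simp: q' Let_def reverse_at_def add_composites_def)
  qed
qed

lemma is_preseed_mutate:
  assumes K: "subfield K ring_of_type_algebra" and S: "is_preseed K n S" and l: "l \<in> {1..n} - frozen S"
  shows "is_preseed K n (mutate n l S)"
  unfolding is_preseed_def
proof (intro conjI allI ballI impI)
  note S' = S[unfolded is_preseed_def]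
  fix i j
  have add: "add_composites l (arrows S) i j \<noteq> 0 \<Longrightarrow> i \<in> {1..n} \<and> j \<in> {1..n}" for i j
    using S' unfolding add_composites_def by (metis add_is_0 mult_is_0)
  show "i \<in> {1..n}" "j \<in> {1..n}" if "arrows (mutate n l S) i j \<noteq> 0"
    using that add[of i j] add[of j i]
    by (auto simp: mutate_def cancel_2_cycles_def reverse_at_def split: if_splits)
  show "arrows (mutate n l S) i i = 0" "arrows (mutate n l S) i j = 0 \<or> arrows (mutate n l S) j i = 0"
    by (auto simp: mutate_def cancel_2_cycles_def)
  show "algebraically_independent K n (cluster (mutate n l S))"
    unfolding cluster_mutate using S' l exchange_binomial_in[OF K S] exchange_binomial_nz[OF K S l]
    by (intro algebraically_independent_exchange[OF K]) auto
  show "i \<in> frozen (mutate n l S)"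
    if "i \<in> {1..n}" "\<forall>j. arrows (mutate n l S) i j = 0 \<and> arrows (mutate n l S) j i = 0"
  proof -
    have "arrows S i j = 0 \<and> arrows S j i = 0" for j
    proof (rule arrows_mutate_isolated)
      show "arrows (mutate n l S) i j = 0 \<and> arrows (mutate n l S) j i = 0" for j
        using that(2) by blast
    qed (use S' in auto)
    thus ?thesis using S' that(1) by (simp add: mutate_def)
  qed
qed

theorem theorem3p7:
  fixes K :: "'f::field set" and p n :: nat
    and \<phi>\<^sub>0 :: "'f alg_closure \<Rightarrow> 'f" and S :: "'f seed"
  assumes "subfield K ring_of_type_algebra"
    and "CHAR('f) = p" and "p > 0"
    and "frobenius_splitting p K \<phi>\<^sub>0"
    and "is_seed K n S"
  shows "(\<forall>T. mutation_equivalent n S T \<longrightarrow>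
            pth_roots p (upper_cluster_algebra K n S) \<subseteq> pth_roots p (laurent_ring K n (cluster T)) \<and>
            frobenius_splitting p (upper_cluster_algebra K n S)
              (standard_splitting K n p \<phi>\<^sub>0 (cluster T))) \<and>
         (\<forall>T T'. mutation_equivalent n S T \<and> mutation_equivalent n S T' \<longrightarrow>
            (\<forall>y \<in> pth_roots p (upper_cluster_algebra K n S).
               standard_splitting K n p \<phi>\<^sub>0 (cluster T) y =
               standard_splitting K n p \<phi>\<^sub>0 (cluster T') y))"
proof -
  note K = assms(1) and char = assms(2,3) and split0 = assms(4)
  let ?U = "upper_cluster_algebra K n S"
  let ?L = "\<lambda>T. laurent_ring K n (cluster T)"
  let ?\<phi> = "\<lambda>T. standard_splitting K n p \<phi>\<^sub>0 (cluster T)"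
  have U_sub: "?U \<subseteq> ?L T" if "mutation_equivalent n S T" for T
    using that by (auto simp: upper_cluster_algebra_def)
  have std: "is_standard_splitting K n p \<phi>\<^sub>0 (cluster T) (?\<phi> T)"
    and nz: "0 \<notin> cluster T ` {1..n}" if "is_preseed K n T" for T
    using that is_standard_splitting_standard_splitting[OF K char split0] algebraically_independent_nz[OF K]
    by (auto simp: is_preseed_def)
  \<comment> \<open>Each splitting is compared with that of \<open>S\<close> along the mutation
    path. The preseed property travels along to supply independence and a nonzero exchange binomial
    at every step.\<close>
  have eq_S: "is_preseed K n T \<and> (\<forall>u\<in>?U. ?\<phi> T (pth_root p u) = ?\<phi> S (pth_root p u))"
    if "mutation_equivalent n S T" for T
    using that unfolding mutation_equivalent_def
  proof (induction rule: rtranclp_induct)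
    case base
    show ?case using assms(5) by (auto simp: is_seed_def is_preseed_def)
  next
    case (step T T')
    then obtain l where l: "l \<in> {1..n} - frozen T" and T': "T' = mutate n l T" by blast
    have T: "is_preseed K n T" using step.IH ..
    have pre': "is_preseed K n T'" unfolding T' by (rule is_preseed_mutate[OF K T l])
    have ST: "mutation_equivalent n S T" "mutation_equivalent n S T'"
      unfolding mutation_equivalent_def
      using step(1) rtranclp.rtrancl_into_rtrancl[OF step(1,2)] by this
    have "?\<phi> T (pth_root p u) = ?\<phi> T' (pth_root p u)" if "u \<in> ?U" for u
      using standard_splitting_exchange[OF K char split0 _ nz[OF T] exchange_binomial_in[OF K T]
          exchange_binomial_nz[OF K T l] std[OF T], of "?\<phi> T'" u]
        std[OF pre'] l U_sub[OF ST(1)] U_sub[OF ST(2)] that unfolding T' cluster_mutate by auto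
    thus ?case using step.IH pre' by simp
  qed
  have in_U: "?\<phi> T (pth_root p u) \<in> ?U" if T: "mutation_equivalent n S T" and u: "u \<in> ?U" for T u
  proof -
    \<comment> \<open>The splitting of \<open>T'\<close> takes values in its own Laurent ring and
      agrees with that of \<open>T\<close> at this root.\<close>
    have "?\<phi> T (pth_root p u) \<in> ?L T'" if T': "mutation_equivalent n S T'" for T'
    proof -
      have "is_preseed K n T'" using eq_S[OF T'] ..
      hence "?\<phi> T' (pth_root p u) \<in> ?L T'"
        using standard_splitting_in[OF K char split0 std nz] U_sub[OF T'] u by blast
      thus ?thesis using eq_S[OF T] eq_S[OF T'] u by simp
    qed
    thus ?thesis by (simp add: upper_cluster_algebra_def)
  qed
  show ?thesis
  proof (intro conjI allI impI ballI)
    fix T assume T: "mutation_equivalent n S T"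
    show "pth_roots p ?U \<subseteq> pth_roots p (?L T)" using U_sub[OF T] by (auto simp: pth_roots_def)
    have "is_preseed K n T" using eq_S[OF T] ..
    thus "frobenius_splitting p ?U (?\<phi> T)"
      using standard_splitting_restricts[OF K char split0 std nz U_sub[OF T] in_U[OF T]] by blast
  next
    fix T T' y
    assume "mutation_equivalent n S T \<and> mutation_equivalent n S T'" "y \<in> pth_roots p ?U"
    thus "?\<phi> T y = ?\<phi> T' y" using eq_S[of T] eq_S[of T'] by (auto elim: pth_rootsE[OF char])
  qed
qed

end
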